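(* Let $n>3$, $\theta_1,\dots,\theta_n\in\mathbb R$, and let $V=|0\rangle\langle0|\otimes I_n+|1\rangle\langle1|\otimes\sum_{j=1}^ne^{i\theta_j}|j\rangle\langle j|$ on $\mathbb C^2\otimes\mathbb C^n$ (a Schmidt-rank-two bipartite unitary). (i) Suppose there exist pairwise distinct indices $i_1,i_2,i_3$ with $\sin^2\frac{\theta_{i_1}-\theta_{i_2}}{2}\sin^2\frac{\theta_{i_2}-\theta_{i_3}}{2}\sin^2\frac{\theta_{i_3}-\theta_{i_1}}{2}>0$ and non-negative reals $c_j$, $j\notin\{i_1,i_2,i_3\}$, such that the numbers $$c_{i_1}=\Big(\tfrac12\cos\tfrac{\theta_{i_2}-\theta_{i_3}}{2}-\sum_{j\ne i_1,i_2,i_3}\sin\tfrac{\theta_j-\theta_{i_2}}{2}\sin\tfrac{\theta_j-\theta_{i_3}}{2}c_j\Big)\csc\tfrac{\theta_{i_1}-\theta_{i_2}}{2}\csc\tfrac{\theta_{i_1}-\theta_{i_3}}{2},$$ $$c_{i_2}=\Big(\tfrac12\cos\tfrac{\theta_{i_1}-\theta_{i_3}}{2}-\sum_{j\ne i_1,i_2,i_3}\sin\tfrac{\theta_j-\theta_{i_1}}{2}\sin\tfrac{\theta_j-\theta_{i_3}}{2}c_j\Big)\csc\tfrac{\theta_{i_2}-\theta_{i_1}}{2}\csc\tfrac{\theta_{i_2}-\theta_{i_3}}{2},$$ $$c_{i_3}=\Big(\tfrac12\cos\tfrac{\theta_{i_1}-\theta_{i_2}}{2}-\sum_{j\ne i_1,i_2,i_3}\sin\tfrac{\theta_j-\theta_{i_1}}{2}\sin\tfrac{\theta_j-\theta_{i_2}}{2}c_j\Big)\csc\tfrac{\theta_{i_3}-\theta_{i_1}}{2}\csc\tfrac{\theta_{i_3}-\theta_{i_2}}{2}$$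 are all non-negative. Then $K_E(V)=1$ ebit. (ii) Otherwise $K_E(V)=\max_{1\le i<j\le n}h(i,j)$ ebits, where $h(i,j)=H\Big(\frac{1-|\cos\frac{\theta_i-\theta_j}{2}|}{2},\frac{1+|\cos\frac{\theta_i-\theta_j}{2}|}{2}\Big)$.
   Context: For a bipartite unitary $V$ on $\mathcal H_A\otimes\mathcal H_B$, the entangling power is $K_E(V)=\max E\big(V(|\phi\rangle_{AR_A}\otimes|\psi\rangle_{BR_B})\big)$, the maximum over pure states on $AR_A$ and $BR_B$ with arbitrary finite-dimensional ancillas $R_A,R_B$ ($V$ acting on $A,B$), where $E(|\chi\rangle)=S(\mathrm{Tr}_{AR_A}|\chi\rangle\langle\chi|)$ is the von Neumann entropy, base-2 logarithm (ebits). $H(p,1-p)=-p\log_2p-(1-p)\log_2(1-p)$. *)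

theory Defs
  imports Complex_Main "Jordan_Normal_Form.Char_Poly"
begin

text \<open>Conventions. Finite-dimensional Hilbert spaces C^d are represented by complex vectors
of dimension d (index set 0..<d). A tensor product C^d1 (x) C^d2 is C^(d1*d2) with the
product basis vector |i> (x) |j> at index i*d2 + j. Indices 1..n of the paper correspond to
0..<n here (paper index j is position j-1).\<close>

definition eta :: "real \<Rightarrow> real" where
  "eta x = (if x \<le> 0 then 0 else - x * log 2 x)"

text \<open>Von Neumann entropy (base 2) of a square complex matrix: the sum of -lambda log2 lambda
over its eigenvalues lambda, counted with algebraic multiplicity (roots of the characteristic
polynomial). For density matrices the eigenvalues are real and non-negative.\<close>
definition vn_entropy :: "complex mat \<Rightarrow> real" where
  "vn_entropy \<rho> =
     (\<Sum>x\<in>{x. poly (char_poly \<rho>) x = 0}.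
        of_nat (order x (char_poly \<rho>)) * eta (Re x))"

definition unit_vec_c :: "nat \<Rightarrow> complex vec \<Rightarrow> bool" where
  "unit_vec_c d v \<longleftrightarrow> dim_vec v = d \<and> (\<Sum>i<d. (cmod (v $ i))\<^sup>2) = 1"

text \<open>Output state V (|phi>_{A R_A} (x) |psi>_{B R_B}), with V acting on A B
(dim A = dA, dim B = dB, dim R_A = p, dim R_B = q, V a (dA*dB) x (dA*dB) matrix),
as a function of the components (a, r, b, s).\<close>
definition out_state ::
  "nat \<Rightarrow> nat \<Rightarrow> complex mat \<Rightarrow> nat \<Rightarrow> nat \<Rightarrow> complex vec \<Rightarrow> complex vec
     \<Rightarrow> nat \<Rightarrow> nat \<Rightarrow> nat \<Rightarrow> nat \<Rightarrow> complex" where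
  "out_state dA dB V p q \<phi> \<psi> a r b s =
     (\<Sum>a'<dA. \<Sum>b'<dB. V $$ (a * dB + b, a' * dB + b') * (\<phi> $ (a' * p + r)) * (\<psi> $ (b' * q + s)))"

text \<open>Reduced density matrix on B R_B (partial trace over A R_A) of the output state;
B R_B basis vector |b>|s> at index b*q + s.\<close>
definition reduced_BR ::
  "nat \<Rightarrow> nat \<Rightarrow> complex mat \<Rightarrow> nat \<Rightarrow> nat \<Rightarrow> complex vec \<Rightarrow> complex vec \<Rightarrow> complex mat" where
  "reduced_BR dA dB V p q \<phi> \<psi> =
     mat (dB * q) (dB * q) (\<lambda>(u, v).
       \<Sum>a<dA. \<Sum>r<p. out_state dA dB V p q \<phi> \<psi> a r (u div q) (u mod q)
                     * cnj (out_state dA dB V p q \<phi> \<psi> a r (v div q) (v mod q)))"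

text \<open>Entangling power K_E(V): supremum (the paper's maximum) of the entanglement entropy of
V(|phi>|psi>) over all finite-dimensional ancillas (dimensions p, q >= 1) and all pure
product input states.\<close>
definition entangling_power :: "nat \<Rightarrow> nat \<Rightarrow> complex mat \<Rightarrow> real" where
  "entangling_power dA dB V =
     Sup {vn_entropy (reduced_BR dA dB V p q \<phi> \<psi>) | p q \<phi> \<psi>.
            p > 0 \<and> q > 0 \<and> unit_vec_c (dA * p) \<phi> \<and> unit_vec_c (dB * q) \<psi>}"

text \<open>V = |0><0| (x) I_n + |1><1| (x) sum_j e^{i theta_j} |j><j| on C^2 (x) C^n
(paper index j = 1..n at position j-1).\<close>
definition ctrl_phase :: "nat \<Rightarrow> (nat \<Rightarrow> real) \<Rightarrow> complex mat" where
  "ctrl_phase n \<theta> = mat (2 * n) (2 * n) (\<lambda>(u, v).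
      if u \<noteq> v then 0
      else if u div n = 0 then 1
      else cis (\<theta> (u mod n + 1)))"

definition bin_entropy :: "real \<Rightarrow> real" where
  "bin_entropy x = eta x + eta (1 - x)"

definition csc :: "real \<Rightarrow> real" where
  "csc x = 1 / sin x"

end

theory Submission
  imports "HOL-Analysis.Convex_Euclidean_Space" Defs
begin

text \<open>The reduced state is a mixture of two pure states with weights \<open>t\<close>, \<open>1 - t\<close> and overlap
  \<open>z = \<Sum>\<^sub>j w\<^sub>j cis \<theta>\<^sub>j\<close>, where \<open>w\<close> is the distribution of the input on \<open>B\<close>. Its nonzero
  eigenvalues are \<open>(1 \<plusminus> sqrt (1 - 4t(1 - t)(1 - |z|\<^sup>2))) / 2\<close>, so \<open>t = 1/2\<close> is optimal and the
  entangling power is the binary entropy of \<open>(1 - m) / 2\<close>, where \<open>m\<close> is the distance of the origin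
  from the convex hull of the points \<open>cis \<theta>\<^sub>j\<close>. The formulas for the three coefficients in the
  condition are the solution of \<open>\<Sum> c\<^sub>j = 1\<close>, \<open>\<Sum> c\<^sub>j cis \<theta>\<^sub>j = 0\<close> for these unknowns, so the
  condition says that the hull contains the origin and that there are three distinct points.
  Otherwise the point of the hull nearest to the origin is the midpoint of a chord.\<close>

unbundle no vec_syntax

section \<open>Characteristic polynomials of \<open>A * B\<close> and \<open>B * A\<close>, and the
  entropy of a product with inner dimension two\<close>

text \<open>Both determinants come from the block matrix \<open>?F\<close>. Clearing its lower left
  block from the right by \<open>?R\<close> gives the determinant with \<open>A * B\<close> as
  \<open>det ?F\<close>; clearing it from the left by \<open>?L\<close> gives the one with
  \<open>B * A\<close>, up to the powers of \<open>x\<close>. Nothing is inverted, so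
  \<open>x\<close> may be an indeterminate.\<close>

lemma det_smult_one_minus_mult_commute:
  fixes A B :: "'a::idom mat"
  assumes A: "A \<in> carrier_mat n m" and B: "B \<in> carrier_mat m n"
  shows "x ^ m * det (x \<cdot>\<^sub>m 1\<^sub>m n - A * B) = x ^ n * det (x \<cdot>\<^sub>m 1\<^sub>m m - B * A)"
proof -
  let ?F = "four_block_mat (x \<cdot>\<^sub>m 1\<^sub>m n) A B (1\<^sub>m m)"
  let ?R = "four_block_mat (1\<^sub>m n) (0\<^sub>m n m) (- B) (1\<^sub>m m)"
  let ?L = "four_block_mat (1\<^sub>m n) (0\<^sub>m n m) (- B) (x \<cdot>\<^sub>m 1\<^sub>m m)"
  have F: "?F \<in> carrier_mat (n + m) (n + m)"
    and R: "?R \<in> carrier_mat (n + m) (n + m)"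
    and L: "?L \<in> carrier_mat (n + m) (n + m)" by auto
  have "?F * ?R = four_block_mat (x \<cdot>\<^sub>m 1\<^sub>m n - A * B) A (0\<^sub>m m n) (1\<^sub>m m)"
    using A B
    by (subst mult_four_block_mat[of _ n n _ m _ m _ _ n _ m])
       (auto simp: minus_add_uminus_mat[of _ n n])
  then have "det ?F * det ?R = det (x \<cdot>\<^sub>m 1\<^sub>m n - A * B)"
    using det_four_block_mat_lower_left_zero[of "x \<cdot>\<^sub>m 1\<^sub>m n - A * B" n A m "0\<^sub>m m n" "1\<^sub>m m"]
      minus_carrier_mat[OF mult_carrier_mat[OF A B], of "x \<cdot>\<^sub>m 1\<^sub>m n"] A B
    by (simp flip: det_mult[OF F R])
  moreover have "det ?R = 1"
    using det_four_block_mat_upper_right_zero[of "1\<^sub>m n" n "0\<^sub>m n m" m "- B" "1\<^sub>m m"] B by simp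
  ultimately have 1: "det ?F = det (x \<cdot>\<^sub>m 1\<^sub>m n - A * B)" by simp
  have "?L * ?F = four_block_mat (x \<cdot>\<^sub>m 1\<^sub>m n) A (0\<^sub>m m n) (x \<cdot>\<^sub>m 1\<^sub>m m - B * A)"
    using A B
    by (subst mult_four_block_mat[of _ n n _ m _ m _ _ n _ m])
       (auto simp: minus_add_uminus_mat[of _ m m] comm_add_mat[of _ m m])
  then have "det ?L * det ?F = x ^ n * det (x \<cdot>\<^sub>m 1\<^sub>m m - B * A)"
    using det_four_block_mat_lower_left_zero[of "x \<cdot>\<^sub>m 1\<^sub>m n" n A m "0\<^sub>m m n" "x \<cdot>\<^sub>m 1\<^sub>m m - B * A"]
      minus_carrier_mat[OF mult_carrier_mat[OF B A], of "x \<cdot>\<^sub>m 1\<^sub>m m"] A B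
    by (simp flip: det_mult[OF L F])
  moreover have "det ?L = x ^ m"
    using det_four_block_mat_upper_right_zero[of "1\<^sub>m n" n "0\<^sub>m n m" m "- B" "x \<cdot>\<^sub>m 1\<^sub>m m"] B by simp
  ultimately show ?thesis using 1 by simp
qed

text \<open>The determinant identity over the polynomial ring, with the indeterminate for
  \<open>x\<close> and the matrix entries embedded as constant polynomials.\<close>

lemma char_poly_mult_commute:
  fixes A B :: "'a::idom mat"
  assumes A: "A \<in> carrier_mat n m" and B: "B \<in> carrier_mat m n"
  shows "[:0, 1:] ^ m * char_poly (A * B) = [:0, 1:] ^ n * char_poly (B * A)"
proof -
  interpret const: semiring_hom "\<lambda>a::'a. [:a:]"
    by unfold_locales (auto simp: one_pCons)
  have cp: "char_poly (C * D)
      = det ([:0, 1:] \<cdot>\<^sub>m 1\<^sub>m k - map_mat (\<lambda>a. [:a:]) C * map_mat (\<lambda>a. [:a:]) D)"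
    if "C \<in> carrier_mat k l" "D \<in> carrier_mat l k" for C D :: "'a mat" and k l
  proof -
    have "char_poly_matrix (C * D)
      = [:0, 1:] \<cdot>\<^sub>m 1\<^sub>m k - map_mat (\<lambda>a. [:a:]) (C * D)"
      using that by (intro eq_matI) (auto simp: char_poly_matrix_def)
    then show ?thesis using that by (simp add: char_poly_def const.mat_hom_mult)
  qed
  show ?thesis
    unfolding cp[OF A B] cp[OF B A] using A B
    by (intro det_smult_one_minus_mult_commute) auto
qed

lemma char_poly_2x2:
  fixes A :: "'a::comm_ring_1 mat"
  assumes "A \<in> carrier_mat 2 2"
  shows "char_poly A = [:A $$ (0,0) * A $$ (1,1) - A $$ (0,1) * A $$ (1,0),
                         - (A $$ (0,0) + A $$ (1,1)), 1:]"
proof -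
  have "char_poly A = det (char_poly_matrix A)" by (simp add: char_poly_def)
  also have "\<dots> = (\<Sum>j<2. char_poly_matrix A $$ (0, j) * cofactor (char_poly_matrix A) 0 j)"
    using assms by (intro laplace_expansion_row) auto
  also have "\<dots> = [:A $$ (0,0) * A $$ (1,1) - A $$ (0,1) * A $$ (1,0),
                         - (A $$ (0,0) + A $$ (1,1)), 1:]"
    using assms
    by (simp add: numeral_2_eq_2 cofactor_def mat_delete_def char_poly_matrix_def det_single)
  finally show ?thesis .
qed

text \<open>The order of a root is its number of occurrences in \<open>as\<close>, which turns the
  multiplicity-weighted sum over distinct roots into a plain sum over the list.\<close>

lemma vn_entropy_of_linear_factors:
  assumes "char_poly A = (\<Prod>a\<leftarrow>as. [:- a, 1:])"
  shows "vn_entropy A = (\<Sum>a\<leftarrow>as. eta (Re a))"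
proof -
  have ord: "order x (\<Prod>a\<leftarrow>as. [:- a, 1:]) = count_list as x" for x
  proof -
    have "order x (\<Prod>a\<leftarrow>as. [:- a, 1:]) = (\<Sum>a\<leftarrow>as. order x [:- a, 1:])"
      by (subst order_prod_list) (auto simp: o_def)
    also have "\<dots> = count_list as x" by (induction as) (auto simp: order_linear')
    finally show ?thesis .
  qed
  have roots: "{x. poly (\<Prod>a\<leftarrow>as. [:- a, 1:]) x = 0} = set as"
    by (auto simp: poly_prod_list prod_list_zero_iff)
  have sum_list_eq: "(\<Sum>x\<in>S. real (count_list xs x) * f x) = (\<Sum>x\<leftarrow>xs. f x)"
    if "set xs \<subseteq> S" "finite S" for xs S and f :: "complex \<Rightarrow> real"
    using that
  proof (induction xs)
    case (Cons a xs)
    have "(\<Sum>x\<in>S. real (count_list (a # xs) x) * f x)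
        = (\<Sum>x\<in>S. real (count_list xs x) * f x + (if x = a then f x else 0))"
      by (intro sum.cong refl) (auto simp: algebra_simps)
    then show ?case using Cons by (simp add: sum.distrib)
  qed auto
  show ?thesis
    unfolding vn_entropy_def assms ord roots
    using sum_list_eq[of as] by simp
qed

text \<open>Besides the two eigenvalues of the small matrix \<open>B * A\<close>, the matrix
  \<open>A * B\<close> has only \<open>N - 2\<close> further zeros, and \<open>eta\<close> vanishes
  there.\<close>

lemma vn_entropy_mult_2:
  assumes A: "A \<in> carrier_mat N 2" and B: "B \<in> carrier_mat 2 N" and "N \<ge> 2"
    and cp: "char_poly (B * A) = [:- a, 1:] * [:- b, 1:]"
  shows "vn_entropy (A * B) = eta (Re a) + eta (Re b)"
proof -
  have "[:0, 1:] ^ 2 * char_poly (A * B) = [:0, 1:] ^ 2 * ([:0, 1:] ^ (N - 2) * char_poly (B * A))"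
    using \<open>N \<ge> 2\<close>
    by (simp only: mult.assoc[symmetric] power_add[symmetric] le_add_diff_inverse
        char_poly_mult_commute[OF A B])
  then have "char_poly (A * B) = [:0, 1:] ^ (N - 2) * char_poly (B * A)" by simp
  then have "char_poly (A * B) = (\<Prod>c\<leftarrow>a # b # replicate (N - 2) 0. [:- c, 1:])"
    unfolding cp by (simp add: ac_simps del: mult_pCons_left mult_pCons_right)
  from vn_entropy_of_linear_factors[OF this] show ?thesis
    by (simp add: eta_def sum_list_replicate)
qed

section \<open>The reduced output state and its spectrum\<close>

lemma out_state_ctrl_phase:
  assumes "a < 2" "b < n"
  shows "out_state 2 n (ctrl_phase n \<theta>) p q \<phi> \<psi> a r b s
    = (if a = 0 then 1 else cis (\<theta> (b + 1))) * \<phi> $ (a * p + r) * \<psi> $ (b * q + s)"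
proof -
  have entry: "ctrl_phase n \<theta> $$ (a * n + b, a' * n + b')
      = (if a' = a then if b' = b then if a = 0 then 1 else cis (\<theta> (b + 1)) else 0 else 0)"
    if "a' < 2" "b' < n" for a' b'
  proof -
    have lt: "c * n + d < 2 * n" if "c < 2" "d < n" for c d
      using that by (cases "c = 0") (auto simp: less_2_cases_iff)
    have "a * n + b = a' * n + b' \<longleftrightarrow> a' = a \<and> b' = b"
    proof
      assume eq: "a * n + b = a' * n + b'"
      have "(a * n + b) div n = a" "(a' * n + b') div n = a'" using that assms by simp_all
      then show "a' = a \<and> b' = b" using eq by auto
    qed auto
    then show ?thesis
      using lt that assms by (auto simp: ctrl_phase_def)
  qed
  have "out_state 2 n (ctrl_phase n \<theta>) p q \<phi> \<psi> a r b s
    = (\<Sum>a'<2. \<Sum>b'<n. if a' = a then if b' = b then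
         (if a = 0 then 1 else cis (\<theta> (b + 1))) * \<phi> $ (a * p + r) * \<psi> $ (b * q + s) else 0 else 0)"
    unfolding out_state_def by (intro sum.cong refl) (auto simp: entry)
  also have "\<dots> = (\<Sum>a'<2. if a' = a then
         (if a = 0 then 1 else cis (\<theta> (b + 1))) * \<phi> $ (a * p + r) * \<psi> $ (b * q + s) else 0)"
    using assms by (intro sum.cong refl) (auto simp: sum.delta)
  also have "\<dots> = (if a = 0 then 1 else cis (\<theta> (b + 1))) * \<phi> $ (a * p + r) * \<psi> $ (b * q + s)"
    using assms by (simp add: sum.delta)
  finally show ?thesis .
qed

lemma sum_lessThan_mult:
  fixes f :: "nat \<Rightarrow> 'a::comm_monoid_add"
  shows "(\<Sum>u<n * q. f u) = (\<Sum>b<n. \<Sum>s<q. f (b * q + s))"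
proof -
  have "(\<Sum>u<n * q. f u) = (\<Sum>b<n. sum f {b * q..<b * q + q})"
    by (simp add: sum.nat_group)
  also have "\<dots> = (\<Sum>b<n. \<Sum>s<q. f (b * q + s))"
    by (subst sum.atLeastLessThan_shift_0) (simp add: lessThan_atLeast0)
  finally show ?thesis .
qed

text \<open>The eigenvalues of a convex combination \<open>t|u><u| + (1 - t)|v><v|\<close> of two pure states depend
  only on \<open>t\<close> and the overlap \<open>|<u|v>|\<close>; they are the eigenvalues of the 2x2 Gram matrix.\<close>

lemma vn_entropy_reduced_ctrl_phase:
  fixes \<theta> :: "nat \<Rightarrow> real"
  assumes n: "n \<ge> 2" and q: "q > 0"
    and \<phi>: "unit_vec_c (2 * p) \<phi>" and \<psi>: "unit_vec_c (n * q) \<psi>"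
  defines "P \<equiv> \<lambda>a. \<Sum>r<p. (cmod (\<phi> $ (a * p + r)))\<^sup>2"
    and "W \<equiv> \<lambda>b. \<Sum>s<q. (cmod (\<psi> $ (b * q + s)))\<^sup>2"
  defines "z \<equiv> \<Sum>b<n. complex_of_real (W b) * cis (\<theta> (b + 1))"
  shows "vn_entropy (reduced_BR 2 n (ctrl_phase n \<theta>) p q \<phi> \<psi>)
    = bin_entropy ((1 - sqrt (1 - 4 * (P 0 * P 1 * (1 - (cmod z)\<^sup>2)))) / 2)"
proof -
  have nsq: "(complex_of_real (cmod w))\<^sup>2 = w * cnj w" for w
    using complex_norm_square[of w] by simp
  define N where "N = n * q"
  define g where "g a b = (if a = 0 then 1 else cis (\<theta> (b + 1)))" for a b :: nat
  \<comment> \<open>Column \<open>a\<close> of \<open>A\<close> is the unnormalised state of B and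
    its ancilla for control value \<open>a\<close>, and \<open>B\<close> is the adjoint of
    \<open>A\<close>. Hence \<open>A * B\<close> is the mixture and \<open>B * A\<close> the Gram
    matrix.\<close>
  define A where "A = mat N 2 (\<lambda>(u, a). sqrt (P a) * (g a (u div q) * \<psi> $ u))"
  define B where "B = mat 2 N (\<lambda>(a, u). sqrt (P a) * cnj (g a (u div q) * \<psi> $ u))"
  have A: "A \<in> carrier_mat N 2" and B: "B \<in> carrier_mat 2 N" by (auto simp: A_def B_def)
  have N: "N \<ge> 2" unfolding N_def using n q by (metis mult_le_mono nat_mult_1_right One_nat_def Suc_leI)
  have P0: "P a \<ge> 0" for a unfolding P_def by (intro sum_nonneg) auto
  have P1: "P 0 + P 1 = 1"
    using \<phi> unfolding unit_vec_c_def sum_lessThan_mult P_def by (simp add: numeral_2_eq_2)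
  have W1: "(\<Sum>b<n. W b) = 1"
    using \<psi> unfolding unit_vec_c_def sum_lessThan_mult W_def by simp
  have sqrtP: "complex_of_real (sqrt (P a)) * complex_of_real (sqrt (P a)) = complex_of_real (P a)" for a
    using P0 by (simp flip: of_real_mult)
  have red: "reduced_BR 2 n (ctrl_phase n \<theta>) p q \<phi> \<psi> = A * B"
  proof (rule eq_matI)
    fix u v assume "u < dim_row (A * B)" "v < dim_col (A * B)"
    then have uv: "u < N" "v < N" using A B by auto
    have out: "out_state 2 n (ctrl_phase n \<theta>) p q \<phi> \<psi> a r (u div q) (u mod q)
        = g a (u div q) * \<phi> $ (a * p + r) * \<psi> $ u" if "a < 2" "u < N" for a r u
      using out_state_ctrl_phase[of a "u div q" n] that q
      by (auto simp: g_def N_def less_mult_imp_div_less)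
    have "reduced_BR 2 n (ctrl_phase n \<theta>) p q \<phi> \<psi> $$ (u, v)
      = (\<Sum>a<2. \<Sum>r<p. (cmod (\<phi> $ (a * p + r)))\<^sup>2 * ((g a (u div q) * \<psi> $ u) * cnj (g a (v div q) * \<psi> $ v)))"
      using uv unfolding reduced_BR_def
      by (auto simp: out N_def[symmetric] nsq mult_ac intro!: sum.cong)
    also have "\<dots> = (\<Sum>a<2. P a * ((g a (u div q) * \<psi> $ u) * cnj (g a (v div q) * \<psi> $ v)))"
      unfolding P_def by (simp flip: sum_distrib_right)
    also have "\<dots> = (\<Sum>a<2. A $$ (u, a) * B $$ (a, v))"
    proof (intro sum.cong refl)
      fix a :: nat assume "a \<in> {..<2}"
      then have "A $$ (u, a) * B $$ (a, v) = (complex_of_real (sqrt (P a)) * complex_of_real (sqrt (P a)))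
          * ((g a (u div q) * \<psi> $ u) * cnj (g a (v div q) * \<psi> $ v))"
        using uv by (simp add: A_def B_def)
      then show "P a * ((g a (u div q) * \<psi> $ u) * cnj (g a (v div q) * \<psi> $ v)) = A $$ (u, a) * B $$ (a, v)"
        unfolding sqrtP by simp
    qed
    also have "\<dots> = (A * B) $$ (u, v)"
      using uv A B by (simp add: scalar_prod_def lessThan_atLeast0)
    finally show "reduced_BR 2 n (ctrl_phase n \<theta>) p q \<phi> \<psi> $$ (u, v) = (A * B) $$ (u, v)" .
  qed (auto simp: reduced_BR_def A_def B_def N_def)
  \<comment> \<open>The phases ignore the ancilla, so the Gram matrix sees \<psi> only through its
    marginal distribution \<open>W\<close>.\<close>
  have BA: "(B * A) $$ (a, a') = sqrt (P a) * sqrt (P a') * (\<Sum>b<n. W b * (cnj (g a b) * g a' b))"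
    if "a < 2" "a' < 2" for a a'
  proof -
    have "(B * A) $$ (a, a') = (\<Sum>u<N. B $$ (a, u) * A $$ (u, a'))"
      using that A B by (simp add: scalar_prod_def lessThan_atLeast0)
    also have "\<dots> = (\<Sum>u<N. sqrt (P a) * sqrt (P a') * ((cmod (\<psi> $ u))\<^sup>2 * (cnj (g a (u div q)) * g a' (u div q))))"
      using that by (intro sum.cong refl) (simp add: A_def B_def nsq mult_ac)
    also have "\<dots> = sqrt (P a) * sqrt (P a') * (\<Sum>u<N. (cmod (\<psi> $ u))\<^sup>2 * (cnj (g a (u div q)) * g a' (u div q)))"
      by (simp add: sum_distrib_left)
    also have "(\<Sum>u<N. (cmod (\<psi> $ u))\<^sup>2 * (cnj (g a (u div q)) * g a' (u div q)))
       = (\<Sum>b<n. \<Sum>s<q. (cmod (\<psi> $ (b * q + s)))\<^sup>2 * (cnj (g a b) * g a' b))"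
      unfolding N_def sum_lessThan_mult by (intro sum.cong refl) (simp add: q)
    also have "\<dots> = (\<Sum>b<n. W b * (cnj (g a b) * g a' b))"
      by (simp add: W_def sum_distrib_right)
    finally show ?thesis .
  qed
  \<comment> \<open>The Gram matrix has trace 1 and determinant \<open>d\<close>; \<open>R\<close>
    is the square root of the discriminant of its characteristic polynomial.\<close>
  define d where "d = P 0 * P 1 * (1 - (cmod z)\<^sup>2)"
  define R where "R = sqrt (1 - 4 * d)"
  have "(P 0 + P 1)\<^sup>2 - 4 * (P 0 * P 1) = (P 0 - P 1)\<^sup>2"
    by (simp add: power2_eq_square algebra_simps)
  then have PP: "4 * (P 0 * P 1) \<le> 1" "P 0 * P 1 \<ge> 0"
    using P1 P0 by (smt (verit) power_one zero_le_power2) (simp add: P0)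
  \<comment> \<open>With \<open>P 0 * P 1\<close> at most 1/4 the discriminant is nonnegative, so
    that \<open>R * R\<close> recovers it.\<close>
  have "d \<le> P 0 * P 1" unfolding d_def using PP by (intro mult_left_le) auto
  then have R2: "R * R = 1 - 4 * d" unfolding R_def using PP by simp
  have "char_poly (B * A) = [:complex_of_real d, - 1, 1:]"
  proof -
    have "(B * A) $$ (a, a) = P a" if "a < 2" for a
    proof -
      have "cnj (g a b) * g a b = 1" for b by (simp add: g_def cis_cnj cis_mult)
      then show ?thesis using BA[OF that that] W1 P0[of a] by (simp add: sqrtP flip: of_real_sum)
    qed
    moreover have "(B * A) $$ (0, 1) = sqrt (P 0) * sqrt (P 1) * z"
      "(B * A) $$ (1, 0) = sqrt (P 0) * sqrt (P 1) * cnj z"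
      by (simp_all add: BA g_def z_def)
    ultimately show ?thesis
      using A B P1
      by (subst char_poly_2x2) (auto simp: d_def nsq algebra_simps sqrtP simp flip: of_real_add)
  qed
  also have "\<dots> = [:- complex_of_real ((1 - R) / 2), 1:] * [:- complex_of_real ((1 + R) / 2), 1:]"
  proof -
    have "complex_of_real d = complex_of_real ((1 - R) / 2 * ((1 + R) / 2))"
      using R2 by (intro arg_cong[of _ _ complex_of_real]) (simp add: field_simps)
    then show ?thesis by (simp add: field_simps)
  qed
  finally have cp: "char_poly (B * A)
      = [:- complex_of_real ((1 - R) / 2), 1:] * [:- complex_of_real ((1 + R) / 2), 1:]" .
  have "vn_entropy (A * B) = eta ((1 - R) / 2) + eta ((1 + R) / 2)"
    using vn_entropy_mult_2[OF A B N cp] by simp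
  moreover have "1 - (1 - R) / 2 = (1 + R) / 2" by (simp add: field_simps)
  ultimately show ?thesis
    unfolding red bin_entropy_def d_def[symmetric] R_def[symmetric] by (simp only:)
qed

section \<open>Binary entropy\<close>

text \<open>With natural logarithms the derivative is \<open>ln (1 - t) - ln t\<close>, nonnegative
  for positive \<open>t\<close> up to 1/2. The endpoint 0, where it does not exist, is settled by
  nonnegativity of the entropy.\<close>

lemma bin_entropy_mono:
  assumes "0 \<le> x" "x \<le> y" "y \<le> 1 / 2"
  shows "bin_entropy x \<le> bin_entropy y"
proof (cases "x = 0")
  case True
  have "eta t \<ge> 0" if "t \<le> 1" for t
    using that by (auto simp: eta_def mult_le_0_iff)
  then show ?thesis
    using True assms by (simp add: bin_entropy_def eta_def[of 0] eta_def[of 1])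
next
  case False
  define f where "f t = - (t * ln t) - (1 - t) * ln (1 - t)" for t :: real
  have "f x \<le> f y"
  proof (rule DERIV_nonneg_imp_nondecreasing[OF assms(2)])
    fix t assume t: "x \<le> t" "t \<le> y"
    then have "0 < t" "t < 1" "t \<le> 1 - t" using assms False by auto
    then have "(f has_real_derivative - (ln t + t * (1 / t)) - (- ln (1 - t) + (1 - t) * (- 1 / (1 - t)))) (at t)"
      unfolding f_def by (auto intro!: derivative_eq_intros)
    then have "(f has_real_derivative (ln (1 - t) - ln t)) (at t)"
      using \<open>0 < t\<close> \<open>t < 1\<close> by simp
    moreover have "ln t \<le> ln (1 - t)" using \<open>0 < t\<close> \<open>t \<le> 1 - t\<close> by simp
    ultimately show "\<exists>d. (f has_real_derivative d) (at t) \<and> 0 \<le> d" by (intro exI conjI) auto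
  qed
  moreover have "bin_entropy t = f t / ln 2" if "0 < t" "t < 1" for t
    using that by (simp add: bin_entropy_def eta_def f_def log_def field_simps)
  ultimately show ?thesis
    using assms False by (simp add: divide_right_mono)
qed

lemma bin_entropy_half: "bin_entropy (1 / 2) = 1"
  by (simp add: bin_entropy_def eta_def log_divide)

section \<open>The trigonometric condition as a statement about convex weights\<close>

text \<open>By the product-to-sum formula, every sum in the condition depends on \<open>c\<close>
  only through its total weight and its cosine and sine moments.\<close>

lemma sum_sin_half_mult_sin_half:
  fixes \<theta> c :: "'i \<Rightarrow> real"
  shows "(\<Sum>j\<in>J. sin ((\<theta> j - \<alpha>) / 2) * sin ((\<theta> j - \<beta>) / 2) * c j)
    = (cos ((\<alpha> - \<beta>) / 2) * (\<Sum>j\<in>J. c j)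
       - (cos ((\<alpha> + \<beta>) / 2) * (\<Sum>j\<in>J. c j * cos (\<theta> j))
          + sin ((\<alpha> + \<beta>) / 2) * (\<Sum>j\<in>J. c j * sin (\<theta> j)))) / 2"
proof -
  have "sin ((x - \<alpha>) / 2) * sin ((x - \<beta>) / 2)
      = (cos ((\<alpha> - \<beta>) / 2) - (cos ((\<alpha> + \<beta>) / 2) * cos x + sin ((\<alpha> + \<beta>) / 2) * sin x)) / 2" for x
  proof -
    have "(x - \<alpha>) / 2 - (x - \<beta>) / 2 = - ((\<alpha> - \<beta>) / 2)"
      "(x - \<alpha>) / 2 + (x - \<beta>) / 2 = x - (\<alpha> + \<beta>) / 2"
      by (simp_all add: field_simps)
    then have "sin ((x - \<alpha>) / 2) * sin ((x - \<beta>) / 2) = (cos ((\<alpha> - \<beta>) / 2) - cos (x - (\<alpha> + \<beta>) / 2)) / 2"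
      unfolding sin_times_sin by (simp only: cos_minus)
    then show ?thesis by (simp only: cos_diff[of x] mult.commute)
  qed
  note product = this
  define K A B where "K = cos ((\<alpha> - \<beta>) / 2)" and "A = cos ((\<alpha> + \<beta>) / 2)" and "B = sin ((\<alpha> + \<beta>) / 2)"
  have "(\<Sum>j\<in>J. sin ((\<theta> j - \<alpha>) / 2) * sin ((\<theta> j - \<beta>) / 2) * c j)
      = (\<Sum>j\<in>J. K / 2 * c j - (A / 2 * (c j * cos (\<theta> j)) + B / 2 * (c j * sin (\<theta> j))))"
    unfolding product K_def[symmetric] A_def[symmetric] B_def[symmetric]
    by (simp add: algebra_simps diff_divide_distrib add_divide_distrib)
  also have "\<dots> = K / 2 * (\<Sum>j\<in>J. c j)
      - (A / 2 * (\<Sum>j\<in>J. c j * cos (\<theta> j)) + B / 2 * (\<Sum>j\<in>J. c j * sin (\<theta> j)))"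
    by (simp only: sum_subtractf sum.distrib sum_distrib_left)
  also have "\<dots> = (K * (\<Sum>j\<in>J. c j)
      - (A * (\<Sum>j\<in>J. c j * cos (\<theta> j)) + B * (\<Sum>j\<in>J. c j * sin (\<theta> j)))) / 2"
    by (simp add: diff_divide_distrib add_divide_distrib)
  finally show ?thesis unfolding K_def A_def B_def .
qed

text \<open>The three equations say that the symmetric bilinear form with matrix
  \<open>((S - C, - D), (- D, S + C))\<close> vanishes on each pair of the vectors \<open>(cos a, sin a)\<close>,
  \<open>(cos b, sin b)\<close>, \<open>(cos c, sin c)\<close>, any two of which span the plane.\<close>

lemma trig_system_trivial:
  fixes S C D :: real
  assumes ab: "S * cos (a - b) = C * cos (a + b) + D * sin (a + b)"
    and bc: "S * cos (b - c) = C * cos (b + c) + D * sin (b + c)"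
    and ac: "S * cos (a - c) = C * cos (a + c) + D * sin (a + c)"
    and "sin (a - b) \<noteq> 0" "sin (b - c) \<noteq> 0" "sin (a - c) \<noteq> 0"
  shows "S = 0 \<and> C = 0 \<and> D = 0"
proof -
  have lin: "u = 0 \<and> v = 0"
    if "u * cos x + v * sin x = 0" "u * cos y + v * sin y = 0" "sin (x - y) \<noteq> 0" for u v x y :: real
  proof -
    have "u * sin (x - y) = (u * cos y + v * sin y) * sin x - (u * cos x + v * sin x) * sin y"
      "v * sin (x - y) = (u * cos x + v * sin x) * cos y - (u * cos y + v * sin y) * cos x"
      by (simp_all add: sin_diff algebra_simps)
    then have "u * sin (x - y) = 0" "v * sin (x - y) = 0" unfolding that(1,2) by simp_all
    then show ?thesis using that(3) by simp
  qed
  have form: "((S - C) * cos x - D * sin x) * cos y + ((S + C) * sin x - D * cos x) * sin y = 0"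
    if "S * cos (x - y) = C * cos (x + y) + D * sin (x + y)" for x y
    using that by (simp add: cos_diff cos_add sin_add algebra_simps)
  have ba: "S * cos (b - a) = C * cos (b + a) + D * sin (b + a)"
    using ab by (metis add.commute cos_minus minus_diff_eq)
  \<comment> \<open>With the first argument fixed at \<open>a\<close>, the form is a linear
    functional vanishing at \<open>b\<close> and \<open>c\<close>, hence zero.\<close>
  have 1: "(S - C) * cos a - D * sin a = 0 \<and> (S + C) * sin a - D * cos a = 0"
    using lin[OF form[OF ab] form[OF ac]] assms by blast
  have 2: "(S - C) * cos b - D * sin b = 0 \<and> (S + C) * sin b - D * cos b = 0"
    using lin[OF form[OF ba] form[OF bc]] assms by blast
  have "S - C = 0 \<and> - D = 0" by (rule lin[of _ a _ b]) (use 1 2 assms in auto)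
  moreover have "- D = 0 \<and> S + C = 0" by (rule lin[of _ a _ b]) (use 1 2 assms in \<open>auto simp: algebra_simps\<close>)
  ultimately show ?thesis by simp
qed

lemma sum_cis_eq_0_iff:
  fixes c :: "'i \<Rightarrow> real"
  shows "(\<Sum>j\<in>J. complex_of_real (c j) * cis (\<theta> j)) = 0
    \<longleftrightarrow> (\<Sum>j\<in>J. c j * cos (\<theta> j)) = 0 \<and> (\<Sum>j\<in>J. c j * sin (\<theta> j)) = 0"
  by (simp add: complex_eq_iff)

text \<open>Each equation is linear in the three moments of \<open>c\<close>. Three pairwise
  distinct points of the circle make the system nonsingular, by \<open>trig_system_trivial\<close>
  at the half angles.\<close>

lemma convex_weights_iff_three_equations:
  fixes \<theta> c :: "'i \<Rightarrow> real"
  assumes "sin ((\<alpha> - \<beta>) / 2) \<noteq> 0" "sin ((\<beta> - \<gamma>) / 2) \<noteq> 0" "sin ((\<alpha> - \<gamma>) / 2) \<noteq> 0"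
  shows "(\<Sum>j\<in>J. c j) = 1 \<and> (\<Sum>j\<in>J. complex_of_real (c j) * cis (\<theta> j)) = 0 \<longleftrightarrow>
      (\<Sum>j\<in>J. sin ((\<theta> j - \<beta>) / 2) * sin ((\<theta> j - \<gamma>) / 2) * c j) = 1 / 2 * cos ((\<beta> - \<gamma>) / 2) \<and>
      (\<Sum>j\<in>J. sin ((\<theta> j - \<alpha>) / 2) * sin ((\<theta> j - \<gamma>) / 2) * c j) = 1 / 2 * cos ((\<alpha> - \<gamma>) / 2) \<and>
      (\<Sum>j\<in>J. sin ((\<theta> j - \<alpha>) / 2) * sin ((\<theta> j - \<beta>) / 2) * c j) = 1 / 2 * cos ((\<alpha> - \<beta>) / 2)"
    (is "?L \<longleftrightarrow> ?R")
proof
  assume ?L then show ?R by (simp add: sum_sin_half_mult_sin_half sum_cis_eq_0_iff)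
next
  assume R: ?R
  \<comment> \<open>Subtracting 1 from the total weight absorbs the right-hand sides and makes the
    system homogeneous.\<close>
  let ?S = "(\<Sum>j\<in>J. c j) - 1" and ?C = "\<Sum>j\<in>J. c j * cos (\<theta> j)" and ?D = "\<Sum>j\<in>J. c j * sin (\<theta> j)"
  have eq: "?S * cos (x / 2 - y / 2) = ?C * cos (x / 2 + y / 2) + ?D * sin (x / 2 + y / 2)"
    if "(\<Sum>j\<in>J. sin ((\<theta> j - x) / 2) * sin ((\<theta> j - y) / 2) * c j) = 1 / 2 * cos ((x - y) / 2)" for x y
  proof -
    have "cos ((x - y) / 2) * (\<Sum>j\<in>J. c j) - (cos ((x + y) / 2) * ?C + sin ((x + y) / 2) * ?D)
        = cos ((x - y) / 2)"
      using that unfolding sum_sin_half_mult_sin_half by simp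
    then show ?thesis
      unfolding diff_divide_distrib[symmetric] add_divide_distrib[symmetric]
      by (simp add: algebra_simps)
  qed
  have "?S = 0 \<and> ?C = 0 \<and> ?D = 0"
    by (rule trig_system_trivial[OF eq[of \<alpha> \<beta>] eq[of \<beta> \<gamma>] eq[of \<alpha> \<gamma>]])
       (use R assms in \<open>simp_all flip: diff_divide_distrib\<close>)
  then show ?L by (simp add: sum_cis_eq_0_iff)
qed

section \<open>Convex hulls of points on the unit circle\<close>

text \<open>The weights are indexed by \<open>J\<close> rather than by points because
  \<open>f\<close> need not be injective: different angles may give the same point.\<close>

lemma convex_hull_subset_weighted_sums:
  fixes f :: "'i \<Rightarrow> 'a::real_vector"
  assumes "finite J"
  shows "convex hull (f ` J) \<subseteq> {\<Sum>j\<in>J. w j *\<^sub>R f j | w. (\<forall>j\<in>J. w j \<ge> 0) \<and> sum w J = 1}" (is "_ \<subseteq> ?K")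
proof (rule hull_minimal)
  show "f ` J \<subseteq> ?K"
  proof
    fix x assume "x \<in> f ` J"
    then obtain i where i: "i \<in> J" "x = f i" by auto
    have "(\<Sum>j\<in>J. (if j = i then 1 else 0) *\<^sub>R f j) = (\<Sum>j\<in>J. if j = i then f j else 0)"
      by (intro sum.cong) auto
    then show "x \<in> ?K"
      using i assms by (intro CollectI exI[of _ "\<lambda>j. if j = i then 1 else 0"]) auto
  qed
  show "convex ?K"
  proof (rule convexI)
    fix x y and u v :: real
    assume "x \<in> ?K" "y \<in> ?K" and uv: "0 \<le> u" "0 \<le> v" "u + v = 1"
    then obtain w w' where w: "x = (\<Sum>j\<in>J. w j *\<^sub>R f j)" "\<forall>j\<in>J. w j \<ge> 0" "sum w J = 1"
      and w': "y = (\<Sum>j\<in>J. w' j *\<^sub>R f j)" "\<forall>j\<in>J. w' j \<ge> 0" "sum w' J = 1" by auto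
    have "u *\<^sub>R x + v *\<^sub>R y = (\<Sum>j\<in>J. (u * w j + v * w' j) *\<^sub>R f j)"
      by (simp add: w(1) w'(1) scaleR_sum_right scaleR_add_left sum.distrib)
    moreover have "(\<Sum>j\<in>J. u * w j + v * w' j) = 1"
      using w(3) w'(3) uv by (simp add: sum.distrib flip: sum_distrib_left)
    ultimately show "u *\<^sub>R x + v *\<^sub>R y \<in> ?K"
      using w w' uv by (intro CollectI exI[of _ "\<lambda>j. u * w j + v * w' j"]) auto
  qed
qed

text \<open>If the point \<open>r cis \<alpha>\<close> of the hull nearest to the origin is not the origin, the supporting
  line there contains all points of positive weight; it meets the circle in at most two points,
  whose chord has its midpoint at distance \<open>r\<close>.\<close>

lemma zero_mean_weights_if_chords_far:
  fixes \<theta> w :: "'i \<Rightarrow> real"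
  assumes J: "finite J" and two: "\<exists>i\<in>J. \<exists>j\<in>J. i \<noteq> j"
    and w: "\<forall>j\<in>J. w j \<ge> 0" "sum w J = 1"
    and far: "\<forall>i\<in>J. \<forall>j\<in>J. i \<noteq> j \<longrightarrow>
      cmod (\<Sum>j\<in>J. complex_of_real (w j) * cis (\<theta> j)) < \<bar>cos ((\<theta> i - \<theta> j) / 2)\<bar>"
  obtains v where "\<forall>j\<in>J. v j \<ge> 0" "sum v J = 1" "(\<Sum>j\<in>J. complex_of_real (v j) * cis (\<theta> j)) = 0"
proof -
  define z where "z = (\<Sum>j\<in>J. complex_of_real (w j) * cis (\<theta> j))"
  define H where "H = convex hull ((\<lambda>j. cis (\<theta> j)) ` J)"
  have mem: "cis (\<theta> j) \<in> H" if "j \<in> J" for j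
    using that unfolding H_def by (intro hull_inc) auto
  have H: "convex H" "closed H" "H \<noteq> {}"
    unfolding H_def using J two
    by (auto intro!: compact_imp_closed finite_imp_compact_convex_hull)
  have "z \<in> H"
    using convex_sum[OF J H(1) w(2), of "\<lambda>j. cis (\<theta> j)"] w mem
    by (simp add: z_def scaleR_conv_of_real)
  define y where "y = closest_point H 0"
  have y: "y \<in> H" "cmod y \<le> cmod z"
    using closest_point_in_set[OF H(2,3)] closest_point_le[OF H(2) \<open>z \<in> H\<close>, of 0]
    by (auto simp: y_def)
  then obtain v where v: "\<forall>j\<in>J. v j \<ge> 0" "sum v J = 1"
    and yv: "y = (\<Sum>j\<in>J. complex_of_real (v j) * cis (\<theta> j))"
    using convex_hull_subset_weighted_sums[OF J, of "\<lambda>j. cis (\<theta> j)"]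
    unfolding H_def by (auto simp: scaleR_conv_of_real)
  have False if "y \<noteq> 0"
  proof -
    define r \<alpha> where "r = cmod y" and "\<alpha> = Arg y"
    have r: "r > 0" and y_polar: "y = r * cis \<alpha>"
      using that by (auto simp: r_def \<alpha>_def rcis_cmod_Arg simp flip: rcis_def)
    \<comment> \<open>Rotating by \<open>- \<alpha>\<close> puts the nearest point on the positive
      real axis, so that cosines measure the component along \<open>y\<close>.\<close>
    have "complex_of_real r = y * cis (- \<alpha>)" by (simp add: y_polar cis_mult)
    also have "\<dots> = (\<Sum>j\<in>J. complex_of_real (v j) * cis (\<theta> j - \<alpha>))"
      by (simp add: yv sum_distrib_right cis_mult mult.assoc)
    finally have mean: "complex_of_real r = (\<Sum>j\<in>J. complex_of_real (v j) * cis (\<theta> j - \<alpha>))" .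
    have cos_mean: "(\<Sum>j\<in>J. v j * cos (\<theta> j - \<alpha>)) = r"
      and sin_mean: "(\<Sum>j\<in>J. v j * sin (\<theta> j - \<alpha>)) = 0"
      using arg_cong[OF mean, of Re] arg_cong[OF mean, of Im] by simp_all
    \<comment> \<open>The variational inequality of the closest point: all points lie on or beyond
      the supporting line.\<close>
    have cos_ge: "cos (\<theta> j - \<alpha>) \<ge> r" if "j \<in> J" for j
    proof -
      have "inner y (cis (\<theta> j) - y) \<ge> 0"
        using closest_point_dot[OF H(1,2) mem[OF that], of 0] by (simp add: y_def)
      moreover have "inner y (cis (\<theta> j) - y) = r * (cos (\<theta> j - \<alpha>) - r)"
        unfolding inner_diff_right power2_norm_eq_inner[symmetric] r_def[symmetric]
        by (simp add: inner_complex_def y_polar cos_diff power2_eq_square algebra_simps)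
      ultimately show ?thesis using r by (simp add: zero_le_mult_iff)
    qed
    have "(\<Sum>j\<in>J. v j * (cos (\<theta> j - \<alpha>) - r)) = 0"
      using cos_mean v(2) by (simp add: right_diff_distrib sum_subtractf flip: sum_distrib_right)
    then have "\<forall>j\<in>J. v j * (cos (\<theta> j - \<alpha>) - r) = 0"
      using J v(1) cos_ge by (subst (asm) sum_nonneg_eq_0_iff) auto
    then have supp: "cos (\<theta> j - \<alpha>) = r" if "j \<in> J" "v j \<noteq> 0" for j
      using that by auto
    obtain i where i: "i \<in> J" "v i \<noteq> 0"
      using v(2) by (metis sum.neutral zero_neq_one)
    show False
    proof (cases "\<forall>j\<in>J. v j \<noteq> 0 \<longrightarrow> sin (\<theta> j - \<alpha>) = sin (\<theta> i - \<alpha>)")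
      case True
      \<comment> \<open>All weight sits at one point of the circle, so \<open>r\<close> is 1, and no
        chord midpoint is farther from the origin than that.\<close>
      have "(\<Sum>j\<in>J. v j * sin (\<theta> j - \<alpha>)) = (\<Sum>j\<in>J. v j * sin (\<theta> i - \<alpha>))"
        using True by (intro sum.cong refl) auto
      then have "sin (\<theta> i - \<alpha>) = 0"
        using sin_mean v(2) by (simp flip: sum_distrib_right)
      then have "r\<^sup>2 = 1"
        using sin_cos_squared_add[of "\<theta> i - \<alpha>"] supp[OF i] by simp
      then have "cmod z \<ge> 1" using r y(2) unfolding r_def power2_eq_1_iff by linarith
      moreover obtain k l where "k \<in> J" "l \<in> J" "k \<noteq> l" using two by blast
      ultimately show False
        using far abs_cos_le_one[of "(\<theta> k - \<theta> l) / 2"] unfolding z_def[symmetric] by fastforce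
    next
      case False
      then obtain j where j: "j \<in> J" "v j \<noteq> 0" "sin (\<theta> j - \<alpha>) \<noteq> sin (\<theta> i - \<alpha>)" by blast
      have sq: "(sin (\<theta> k - \<alpha>))\<^sup>2 = 1 - r\<^sup>2" if "k \<in> J" "v k \<noteq> 0" for k
        using sin_cos_squared_add[of "\<theta> k - \<alpha>"] supp[OF that] by simp
      then have "sin (\<theta> j - \<alpha>) = - sin (\<theta> i - \<alpha>)"
        using i j by (metis power2_eq_iff)
      \<comment> \<open>The two rotated points are complex conjugates with real part
        \<open>r\<close>; the half-angle formula then places the midpoint of their chord at distance
        \<open>r\<close>, which is at most \<open>cmod z\<close>.\<close>
      then have "cos ((\<theta> i - \<alpha>) - (\<theta> j - \<alpha>)) = 2 * r\<^sup>2 - 1"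
        unfolding cos_diff[of "\<theta> i - \<alpha>" "\<theta> j - \<alpha>"]
        using i j supp sq[OF i] by (simp add: power2_eq_square)
      moreover have "\<theta> i - \<theta> j = 2 * ((\<theta> i - \<theta> j) / 2)" by simp
      then have "cos (\<theta> i - \<theta> j) = 2 * (cos ((\<theta> i - \<theta> j) / 2))\<^sup>2 - 1"
        by (metis cos_double_cos)
      ultimately have "(cos ((\<theta> i - \<theta> j) / 2))\<^sup>2 = r\<^sup>2" by simp
      then have "\<bar>cos ((\<theta> i - \<theta> j) / 2)\<bar> = r" using r by (auto simp: power2_eq_iff)
      moreover have "i \<noteq> j" using j by auto
      ultimately show False using far i j y(2) unfolding z_def[symmetric] r_def by fastforce
    qed
  qed
  then show thesis using that v yv by metis
qed

section \<open>Output entropies in terms of the input distribution on B\<close>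

text \<open>Since \<open>4 * (a * b)\<close> is at most 1, with equality at \<open>a = b\<close>,
  the balanced input on A gives the smallest root and thereby the largest entropy.\<close>

lemma le_sqrt_one_minus_product:
  fixes a b m :: real
  assumes "a + b = 1" "0 \<le> m" "m \<le> 1"
  shows "m \<le> sqrt (1 - 4 * (a * b * (1 - m\<^sup>2)))"
proof (rule real_le_rsqrt)
  have "1 - 4 * (a * b) = (a - b)\<^sup>2"
    unfolding eq_diff_eq[THEN iffD2, OF assms(1)] by (simp add: power2_eq_square algebra_simps)
  then have "4 * (a * b) \<le> 1" by (smt (verit) zero_le_power2)
  moreover have "1 - m\<^sup>2 \<ge> 0" using assms by (simp add: power_le_one)
  ultimately have "4 * (a * b) * (1 - m\<^sup>2) \<le> 1 * (1 - m\<^sup>2)" by (rule mult_right_mono)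
  then show "m\<^sup>2 \<le> 1 - 4 * (a * b * (1 - m\<^sup>2))" by simp
qed

definition output_entropies :: "nat \<Rightarrow> nat \<Rightarrow> complex mat \<Rightarrow> real set" where
  "output_entropies dA dB V = {vn_entropy (reduced_BR dA dB V p q \<phi> \<psi>) | p q \<phi> \<psi>.
     p > 0 \<and> q > 0 \<and> unit_vec_c (dA * p) \<phi> \<and> unit_vec_c (dB * q) \<psi>}"

text \<open>The weights are the marginal distribution of \<psi> on B; the bound replaces the
  distribution on A by the balanced one.\<close>

lemma output_entropy_le:
  assumes "e \<in> output_entropies 2 n (ctrl_phase n \<theta>)" "n \<ge> 2"
  obtains w where "\<forall>j\<in>{1..n}. w j \<ge> 0" "sum w {1..n} = 1"
    "cmod (\<Sum>j=1..n. complex_of_real (w j) * cis (\<theta> j)) \<le> 1"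
    "e \<le> bin_entropy ((1 - cmod (\<Sum>j=1..n. complex_of_real (w j) * cis (\<theta> j))) / 2)"
proof -
  obtain p q \<phi> \<psi> where q: "q > 0"
    and \<phi>: "unit_vec_c (2 * p) \<phi>" and \<psi>: "unit_vec_c (n * q) \<psi>"
    and e: "e = vn_entropy (reduced_BR 2 n (ctrl_phase n \<theta>) p q \<phi> \<psi>)"
    using assms(1) unfolding output_entropies_def by blast
  define P where "P a = (\<Sum>r<p. (cmod (\<phi> $ (a * p + r)))\<^sup>2)" for a
  \<comment> \<open>The shift \<open>j - 1\<close> translates phase indices, which start at 1, into
    vector positions, which start at 0.\<close>
  define w where "w j = (\<Sum>s<q. (cmod (\<psi> $ ((j - 1) * q + s)))\<^sup>2)" for j
  define z where "z = (\<Sum>j=1..n. complex_of_real (w j) * cis (\<theta> j))"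
  have w0: "w j \<ge> 0" for j unfolding w_def by (intro sum_nonneg) auto
  have P0: "P a \<ge> 0" for a unfolding P_def by (intro sum_nonneg) auto
  have w1: "sum w {1..n} = 1"
    using \<psi> by (simp add: unit_vec_c_def sum_lessThan_mult w_def sum.atLeast1_atMost_eq)
  have P1: "P 0 + P 1 = 1"
    using \<phi> unfolding unit_vec_c_def sum_lessThan_mult P_def by (simp add: numeral_2_eq_2)
  have "cmod z \<le> sum w {1..n}"
    unfolding z_def by (intro sum_norm_le) (simp add: norm_mult w0)
  then have z1: "cmod z \<le> 1" using w1 by simp
  have "z = (\<Sum>b<n. complex_of_real (\<Sum>s<q. (cmod (\<psi> $ (b * q + s)))\<^sup>2) * cis (\<theta> (b + 1)))"
    by (simp add: z_def w_def sum.atLeast1_atMost_eq)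
  then have e_eq: "e = bin_entropy ((1 - sqrt (1 - 4 * (P 0 * P 1 * (1 - (cmod z)\<^sup>2)))) / 2)"
    unfolding e P_def
    using vn_entropy_reduced_ctrl_phase[OF assms(2) q \<phi> \<psi>, of \<theta>] by simp
  have "0 \<le> P 0 * P 1 * (1 - (cmod z)\<^sup>2)"
    using P0 z1 by (simp add: power_le_one)
  then have "sqrt (1 - 4 * (P 0 * P 1 * (1 - (cmod z)\<^sup>2))) \<le> 1" by simp
  then have "e \<le> bin_entropy ((1 - cmod z) / 2)"
    unfolding e_eq using le_sqrt_one_minus_product[OF P1 norm_ge_zero z1]
    by (intro bin_entropy_mono) auto
  then show thesis using that[of w] w0 w1 z1 unfolding z_def by blast
qed

text \<open>Trivial ancillas suffice: the balanced state on A and amplitudes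
  \<open>sqrt (w j)\<close> on B turn the bound of \<open>output_entropy_le\<close> into an
  equality.\<close>

lemma weights_output_entropy:
  assumes w: "\<forall>j\<in>{1..n}. w j \<ge> 0" "sum w {1..n} = 1" and n: "n \<ge> 2"
  shows "bin_entropy ((1 - cmod (\<Sum>j=1..n. complex_of_real (w j) * cis (\<theta> j))) / 2)
    \<in> output_entropies 2 n (ctrl_phase n \<theta>)"
proof -
  define \<phi> where "\<phi> = vec 2 (\<lambda>_. complex_of_real (sqrt (1 / 2)))"
  define \<psi> where "\<psi> = vec n (\<lambda>b. complex_of_real (sqrt (w (b + 1))))"
  have sq: "(cmod (\<psi> $ b))\<^sup>2 = w (b + 1)" if "b < n" for b
    using that w(1) by (simp add: \<psi>_def)
  have \<phi>: "unit_vec_c (2 * 1) \<phi>"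
    by (simp add: unit_vec_c_def \<phi>_def numeral_2_eq_2)
  have \<psi>: "unit_vec_c (n * 1) \<psi>"
    using w(2) sq by (simp add: unit_vec_c_def \<psi>_def sum.atLeast1_atMost_eq)
  have "vn_entropy (reduced_BR 2 n (ctrl_phase n \<theta>) 1 1 \<phi> \<psi>)
      = bin_entropy ((1 - cmod (\<Sum>j=1..n. complex_of_real (w j) * cis (\<theta> j))) / 2)"
    using vn_entropy_reduced_ctrl_phase[of n 1 1 \<phi> \<psi> \<theta>] n \<phi> \<psi>
    by (simp add: sq \<phi>_def power_divide diff_divide_distrib sum.atLeast1_atMost_eq)
  then show ?thesis
    using \<phi> \<psi> unfolding output_entropies_def
    by (intro CollectI exI[of _ 1] exI[of _ \<phi>] exI[of _ \<psi>]) auto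
qed

text \<open>Identifies the overlap for weights 1/2, 1/2 on two indices with the cosine in the
  claimed maximum.\<close>

lemma cmod_midpoint_cis: "cmod ((cis a + cis b) / 2) = \<bar>cos ((a - b) / 2)\<bar>"
proof -
  have "cis a + cis b = 2 * cos ((a - b) / 2) * cis ((a + b) / 2)"
    by (simp add: complex_eq_iff cos_plus_cos sin_plus_sin)
  then show ?thesis by (simp add: norm_mult)
qed

lemma sum_diff3:
  fixes f :: "'a \<Rightarrow> 'b::ab_group_add"
  assumes "finite J" "{a, b, c} \<subseteq> J" "a \<noteq> b" "b \<noteq> c" "a \<noteq> c"
  shows "sum f J = f a + f b + f c + sum f (J - {a, b, c})"
  using sum.subset_diff[OF assms(2,1), of f] assms(3-) by (simp add: algebra_simps)

section \<open>The two cases of the entangling power\<close>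

theorem theorem4:
  fixes n :: nat and \<theta> :: "nat \<Rightarrow> real"
  assumes "n > 3"
  defines "cond \<equiv> (\<exists>i1\<in>{1..n}. \<exists>i2\<in>{1..n}. \<exists>i3\<in>{1..n}.
      i1 \<noteq> i2 \<and> i2 \<noteq> i3 \<and> i1 \<noteq> i3 \<and>
      (sin ((\<theta> i1 - \<theta> i2) / 2))\<^sup>2 * (sin ((\<theta> i2 - \<theta> i3) / 2))\<^sup>2
        * (sin ((\<theta> i3 - \<theta> i1) / 2))\<^sup>2 > 0 \<and>
      (\<exists>c :: nat \<Rightarrow> real.
         (\<forall>j\<in>{1..n} - {i1, i2, i3}. c j \<ge> 0) \<and>
         (1/2 * cos ((\<theta> i2 - \<theta> i3) / 2)
            - (\<Sum>j\<in>{1..n} - {i1, i2, i3}. sin ((\<theta> j - \<theta> i2) / 2) * sin ((\<theta> j - \<theta> i3) / 2) * c j))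
           * csc ((\<theta> i1 - \<theta> i2) / 2) * csc ((\<theta> i1 - \<theta> i3) / 2) \<ge> 0 \<and>
         (1/2 * cos ((\<theta> i1 - \<theta> i3) / 2)
            - (\<Sum>j\<in>{1..n} - {i1, i2, i3}. sin ((\<theta> j - \<theta> i1) / 2) * sin ((\<theta> j - \<theta> i3) / 2) * c j))
           * csc ((\<theta> i2 - \<theta> i1) / 2) * csc ((\<theta> i2 - \<theta> i3) / 2) \<ge> 0 \<and>
         (1/2 * cos ((\<theta> i1 - \<theta> i2) / 2)
            - (\<Sum>j\<in>{1..n} - {i1, i2, i3}. sin ((\<theta> j - \<theta> i1) / 2) * sin ((\<theta> j - \<theta> i2) / 2) * c j))
           * csc ((\<theta> i3 - \<theta> i1) / 2) * csc ((\<theta> i3 - \<theta> i2) / 2) \<ge> 0))"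
  shows "(cond \<longrightarrow> entangling_power 2 n (ctrl_phase n \<theta>) = 1) \<and>
         (\<not> cond \<longrightarrow> entangling_power 2 n (ctrl_phase n \<theta>) =
            Max {bin_entropy ((1 - \<bar>cos ((\<theta> i - \<theta> j) / 2)\<bar>) / 2) | i j.
                   1 \<le> i \<and> i < j \<and> j \<le> n})"

proof -
  let ?V = "ctrl_phase n \<theta>" and ?J = "{1..n}"
  let ?z = "\<lambda>w. \<Sum>j=1..n. complex_of_real (w j) * cis (\<theta> j)"
  have n2: "n \<ge> 2" using \<open>n > 3\<close> by simp
  have K: "entangling_power 2 n ?V = Sup (output_entropies 2 n ?V)"
    by (simp add: entangling_power_def output_entropies_def)
  have "entangling_power 2 n ?V = 1" if cond
  proof -
    from that[unfolded cond_def] obtain a b c w where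
      abc: "a \<in> ?J" "b \<in> ?J" "c \<in> ?J" "a \<noteq> b" "b \<noteq> c" "a \<noteq> c" and
      sines: "(sin ((\<theta> a - \<theta> b) / 2))\<^sup>2 * (sin ((\<theta> b - \<theta> c) / 2))\<^sup>2 * (sin ((\<theta> c - \<theta> a) / 2))\<^sup>2 > 0" and
      w: "\<forall>j\<in>?J - {a, b, c}. w j \<ge> 0" and
      wa: "(1/2 * cos ((\<theta> b - \<theta> c) / 2)
            - (\<Sum>j\<in>?J - {a, b, c}. sin ((\<theta> j - \<theta> b) / 2) * sin ((\<theta> j - \<theta> c) / 2) * w j))
           * csc ((\<theta> a - \<theta> b) / 2) * csc ((\<theta> a - \<theta> c) / 2) \<ge> 0" (is "?wa \<ge> 0") and
      wb: "(1/2 * cos ((\<theta> a - \<theta> c) / 2)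
            - (\<Sum>j\<in>?J - {a, b, c}. sin ((\<theta> j - \<theta> a) / 2) * sin ((\<theta> j - \<theta> c) / 2) * w j))
           * csc ((\<theta> b - \<theta> a) / 2) * csc ((\<theta> b - \<theta> c) / 2) \<ge> 0" (is "?wb \<ge> 0") and
      wc: "(1/2 * cos ((\<theta> a - \<theta> b) / 2)
            - (\<Sum>j\<in>?J - {a, b, c}. sin ((\<theta> j - \<theta> a) / 2) * sin ((\<theta> j - \<theta> b) / 2) * w j))
           * csc ((\<theta> c - \<theta> a) / 2) * csc ((\<theta> c - \<theta> b) / 2) \<ge> 0" (is "?wc \<ge> 0")
      by blast
    \<comment> \<open>The condition leaves the values of \<open>w\<close> at \<open>a\<close>,
      \<open>b\<close>, \<open>c\<close> free; they are overwritten by the three given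
      formulas.\<close>
    define v where "v = w(a := ?wa, b := ?wb, c := ?wc)"
    have v: "v a = ?wa" "v b = ?wb" "v c = ?wc" using abc by (auto simp: v_def)
    have v_rest: "v j = w j" if "j \<in> ?J - {a, b, c}" for j using that by (simp add: v_def)
    have flip: "sin ((x - y) / 2) \<noteq> 0 \<longleftrightarrow> sin ((y - x) / 2) \<noteq> 0" for x y :: real
      using sin_minus[of "(x - y) / 2"] by (simp add: minus_divide_left)
    have ab: "sin ((\<theta> a - \<theta> b) / 2) \<noteq> 0" and bc: "sin ((\<theta> b - \<theta> c) / 2) \<noteq> 0"
      and ca: "sin ((\<theta> c - \<theta> a) / 2) \<noteq> 0" using sines by auto
    have ba: "sin ((\<theta> b - \<theta> a) / 2) \<noteq> 0" and cb: "sin ((\<theta> c - \<theta> b) / 2) \<noteq> 0"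
      and ac: "sin ((\<theta> a - \<theta> c) / 2) \<noteq> 0" using ab bc ca flip by blast+
    have rest: "(\<Sum>j\<in>?J - {a, b, c}. sin ((\<theta> j - x) / 2) * sin ((\<theta> j - y) / 2) * v j)
        = (\<Sum>j\<in>?J - {a, b, c}. sin ((\<theta> j - x) / 2) * sin ((\<theta> j - y) / 2) * w j)" for x y
      by (intro sum.cong refl) (simp add: v_rest)
    have split: "sum f ?J = f a + f b + f c + sum f (?J - {a, b, c})" for f :: "nat \<Rightarrow> real"
      using abc by (intro sum_diff3) auto
    \<comment> \<open>In each of the three equations two of the split-off terms contain
      \<open>sin 0\<close>; the third cancels against the cosecants in its formula.\<close>
    have "sum v ?J = 1 \<and> ?z v = 0"
      by (rule iffD2[OF convex_weights_iff_three_equations[OF ab bc ac]], unfold split rest v csc_def)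
        (use ab ba bc cb ca ac in simp)
    moreover have "\<forall>j\<in>?J. v j \<ge> 0" using w wa wb wc by (auto simp: v_def)
    ultimately have "bin_entropy ((1 - cmod 0) / 2) \<in> output_entropies 2 n ?V"
      using weights_output_entropy[of n v \<theta>] n2 by metis
    then have "1 \<in> output_entropies 2 n ?V" by (simp add: bin_entropy_half)
    moreover have "e \<le> 1" if e: "e \<in> output_entropies 2 n ?V" for e
    proof -
      obtain w where "cmod (?z w) \<le> 1" "e \<le> bin_entropy ((1 - cmod (?z w)) / 2)"
        using output_entropy_le[OF e n2] by metis
      moreover have "bin_entropy ((1 - cmod (?z w)) / 2) \<le> bin_entropy (1 / 2)"
        using \<open>cmod (?z w) \<le> 1\<close> by (intro bin_entropy_mono) auto
      ultimately show ?thesis by (simp add: bin_entropy_half)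
    qed
    ultimately show ?thesis unfolding K by (rule cSup_eq_maximum)
  qed
  moreover have "entangling_power 2 n ?V = Max {bin_entropy ((1 - \<bar>cos ((\<theta> i - \<theta> j) / 2)\<bar>) / 2) | i j.
      1 \<le> i \<and> i < j \<and> j \<le> n}" (is "_ = Max ?M") if "\<not> cond"
  proof -
    let ?h = "\<lambda>i j. bin_entropy ((1 - \<bar>cos ((\<theta> i - \<theta> j) / 2)\<bar>) / 2)"
    have "?M \<subseteq> (\<lambda>(i, j). ?h i j) ` (?J \<times> ?J)" by auto
    then have fin: "finite ?M" by (rule finite_subset) auto
    have "?h 1 2 \<in> ?M" using n2 by (intro CollectI exI[of _ 1] exI[of _ 2] conjI refl) auto
    then have "Max ?M \<in> ?M" using fin by (intro Max_in) auto
    then obtain i j where ij: "1 \<le> i" "i < j" "j \<le> n" "Max ?M = ?h i j" by auto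
    \<comment> \<open>Equal weights on a maximising pair, so that the mean is the midpoint of its
      chord.\<close>
    define w :: "nat \<Rightarrow> real" where "w = (\<lambda>k. (if k = i then 1 / 2 else 0) + (if k = j then 1 / 2 else 0))"
    have w: "\<forall>k\<in>?J. w k \<ge> 0" "sum w ?J = 1" using ij by (simp_all add: w_def sum.distrib)
    have "?z w = (\<Sum>k=1..n. (if k = i then cis (\<theta> k) / 2 else 0) + (if k = j then cis (\<theta> k) / 2 else 0))"
      by (intro sum.cong refl) (simp add: w_def)
    then have zw: "?z w = (cis (\<theta> i) + cis (\<theta> j)) / 2"
      using ij by (simp add: sum.distrib add_divide_distrib)
    have "Max ?M \<in> output_entropies 2 n ?V"
      using weights_output_entropy[OF w n2, of \<theta>] by (simp only: zw cmod_midpoint_cis ij(4))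
    moreover have "e \<le> Max ?M" if e: "e \<in> output_entropies 2 n ?V" for e
    proof -
      obtain w where w: "\<forall>j\<in>?J. w j \<ge> 0" "sum w ?J = 1"
        and z1: "cmod (?z w) \<le> 1" and e_le: "e \<le> bin_entropy ((1 - cmod (?z w)) / 2)"
        using output_entropy_le[OF e n2] by metis
      \<comment> \<open>Some chord midpoint is at least as close to the origin as the mean;
        otherwise the origin is a convex combination of the points, which leads to
        \<open>cond\<close>.\<close>
      have "\<exists>i\<in>?J. \<exists>j\<in>?J. i \<noteq> j \<and> \<bar>cos ((\<theta> i - \<theta> j) / 2)\<bar> \<le> cmod (?z w)"
      proof (rule ccontr)
        assume "\<not> ?thesis"
        then have far: "\<forall>i\<in>?J. \<forall>j\<in>?J. i \<noteq> j \<longrightarrow> cmod (?z w) < \<bar>cos ((\<theta> i - \<theta> j) / 2)\<bar>"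
          by (auto simp: not_le)
        have "1 \<in> ?J" "2 \<in> ?J" "(1::nat) \<noteq> 2" using n2 by auto
        then have two: "\<exists>i\<in>?J. \<exists>j\<in>?J. i \<noteq> j" by blast
        obtain v where v: "\<forall>j\<in>?J. v j \<ge> 0" "sum v ?J = 1" "?z v = 0"
          using zero_mean_weights_if_chords_far[OF finite_atLeastAtMost two w far] by metis
        \<comment> \<open>If every point coincided with point \<open>i\<close> or point
          \<open>j\<close>, the sine sum would vanish termwise. As \<open>v\<close> has mean 0, this
          forces the two points to be antipodal, and then their chord passes through the origin,
          against \<open>far\<close>. Applied first with \<open>i = j\<close> and then with two
          distinct points, this yields three distinct points.\<close>
        have third: "\<exists>k\<in>?J. sin ((\<theta> k - \<theta> i) / 2) \<noteq> 0 \<and> sin ((\<theta> k - \<theta> j) / 2) \<noteq> 0"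
          if "i \<in> ?J" "j \<in> ?J" for i j
        proof (rule ccontr)
          assume "\<not> ?thesis"
          then have "(\<Sum>k\<in>?J. sin ((\<theta> k - \<theta> i) / 2) * sin ((\<theta> k - \<theta> j) / 2) * v k) = 0"
            by (intro sum.neutral) auto
          then have "cos ((\<theta> i - \<theta> j) / 2) = 0"
            using v(2,3) by (simp add: sum_sin_half_mult_sin_half sum_cis_eq_0_iff)
          moreover from this have "i \<noteq> j" by auto
          ultimately show False using far that norm_ge_zero[of "?z w"] by force
        qed
        obtain a where a: "a \<in> ?J" using two by blast
        obtain b where b: "b \<in> ?J" "sin ((\<theta> b - \<theta> a) / 2) \<noteq> 0" using third[OF a a] by blast
        obtain c where c: "c \<in> ?J" "sin ((\<theta> c - \<theta> a) / 2) \<noteq> 0" "sin ((\<theta> c - \<theta> b) / 2) \<noteq> 0"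
          using third[OF a b(1)] by blast
        have neg: "sin ((x - y) / 2) = - sin ((y - x) / 2)" for x y :: real
          using sin_minus[of "(y - x) / 2"] by (simp add: minus_divide_left)
        have ab: "sin ((\<theta> a - \<theta> b) / 2) \<noteq> 0" and bc: "sin ((\<theta> b - \<theta> c) / 2) \<noteq> 0"
          and ac: "sin ((\<theta> a - \<theta> c) / 2) \<noteq> 0"
          using b c neg[of "\<theta> a" "\<theta> b"] neg[of "\<theta> b" "\<theta> c"] neg[of "\<theta> a" "\<theta> c"] by auto
        have abc: "a \<noteq> b" "b \<noteq> c" "a \<noteq> c" using ab bc ac by auto
        have split: "sum f ?J = f a + f b + f c + sum f (?J - {a, b, c})" for f :: "nat \<Rightarrow> real"
          using abc a b c by (intro sum_diff3) auto
        \<comment> \<open>The three equations for \<open>v\<close>, solved for its values at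
          \<open>a\<close>, \<open>b\<close>, \<open>c\<close>: the expressions in the condition are
          exactly these nonnegative weights.\<close>
        have eqs: "(1/2 * cos ((\<theta> b - \<theta> c) / 2)
            - (\<Sum>j\<in>?J - {a, b, c}. sin ((\<theta> j - \<theta> b) / 2) * sin ((\<theta> j - \<theta> c) / 2) * v j))
             = v a * sin ((\<theta> a - \<theta> b) / 2) * sin ((\<theta> a - \<theta> c) / 2)"
          "(1/2 * cos ((\<theta> a - \<theta> c) / 2)
            - (\<Sum>j\<in>?J - {a, b, c}. sin ((\<theta> j - \<theta> a) / 2) * sin ((\<theta> j - \<theta> c) / 2) * v j))
             = v b * sin ((\<theta> b - \<theta> a) / 2) * sin ((\<theta> b - \<theta> c) / 2)"
          "(1/2 * cos ((\<theta> a - \<theta> b) / 2)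
            - (\<Sum>j\<in>?J - {a, b, c}. sin ((\<theta> j - \<theta> a) / 2) * sin ((\<theta> j - \<theta> b) / 2) * v j))
             = v c * sin ((\<theta> c - \<theta> a) / 2) * sin ((\<theta> c - \<theta> b) / 2)"
          using convex_weights_iff_three_equations[OF ab bc ac, of v ?J \<theta>] v(2,3)
          unfolding split by (simp_all add: mult_ac)
        have cond
          unfolding cond_def
          apply (rule bexI[OF _ a], rule bexI[OF _ b(1)], rule bexI[OF _ c(1)])
          apply (intro conjI exI[of _ v] abc)
          unfolding eqs csc_def
          using ab bc ac b(2) c(2,3) v(1) a b(1) c(1) by auto
        then show False using \<open>\<not> cond\<close> by simp
      qed
      then obtain i j where ij: "i \<in> ?J" "j \<in> ?J" "i \<noteq> j"
        and le: "\<bar>cos ((\<theta> i - \<theta> j) / 2)\<bar> \<le> cmod (?z w)" by blast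
      have h_sym: "?h i j = ?h j i" using cos_minus[of "(\<theta> i - \<theta> j) / 2"] by (simp add: minus_divide_left)
      have "?h i j \<in> ?M"
      proof (cases "i < j")
        case True
        then show ?thesis using ij by (intro CollectI exI[of _ i] exI[of _ j] conjI refl) auto
      next
        case False
        then show ?thesis using ij by (intro CollectI exI[of _ j] exI[of _ i] conjI h_sym) auto
      qed
      then have "?h i j \<le> Max ?M" using fin by (rule Max_ge[rotated])
      moreover have "bin_entropy ((1 - cmod (?z w)) / 2) \<le> ?h i j"
        using le z1 by (intro bin_entropy_mono) auto
      ultimately show ?thesis using e_le by linarith
    qed
    ultimately show ?thesis unfolding K by (rule cSup_eq_maximum)
  qed
  ultimately show ?thesis by blast
qed

end
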